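(* Let $m\ge1$, let $\mathbf X^{m-1},\mathbf X^m\in[\mathcal V^h]^3$ and $H^{m-1},H^m\in\mathcal V^h$ be given, let $\widetilde{\mathbf X}^{m+1},\widetilde{\mathbf X}^{m+\frac12},\widetilde{\mathbf X}^{m-\frac12}\in[\mathcal V^h]^3$ be the BGN1-predicted nodal maps (see context), with surfaces $\widetilde S^{m+1},\widetilde S^{m+\frac12},\widetilde S^{m-\frac12}$, and let $(\mathbf X^{m+1},H^{m+1})\in[\mathcal V^h]^3\times\mathcal V^h$ be a solution of the BGN/VC scheme, i.e. for all $(\varphi^h,\boldsymbol\omega^h)\in\mathcal V^h\times[\mathcal V^h]^3$, $$ \begin{aligned} &\frac{7}{90}\left[\left(\frac{3\mathbf X^{m+1}-4\mathbf X^m+\mathbf X^{m-1}}{2\tau},\varphi^h\mathbf n^{m+1}\right)^h_{\widetilde S^{m+1}}+\left(\nabla_{\widetilde S^{m+1}}H^{m+1},\nabla_{\widetilde S^{m+1}}\varphi^h\right)_{\widetilde S^{m+1}}\right]\\ &+\frac{32}{90}\left[\left(\frac{\mathbf X^{m+1}-\mathbf X^m}{\tau},\varphi^h\mathbf n^{m+\frac12}\right)^h_{\widetilde S^{m+\frac12}}+\left(\nabla_{\widetilde S^{m+\frac12}}\frac{H^{m+1}+H^m}{2},\nabla_{\widetilde S^{m+\frac12}}\varphi^h\right)_{\widetilde S^{m+\frac12}}\right]\\ &+\frac{12}{90}\left[\left(\frac{\mathbf X^{m+1}-\mathbf X^{m-1}}{2\tau},\varphi^h\mathbf n^{m}\right)^h_{S^m}+\left(\nabla_{S^m}H^m,\nabla_{S^m}\varphi^h\right)_{S^m}\right]\\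 &+\frac{32}{90}\left[\left(\frac{\mathbf X^{m}-\mathbf X^{m-1}}{\tau},\varphi^h\mathbf n^{m-\frac12}\right)^h_{\widetilde S^{m-\frac12}}+\left(\nabla_{\widetilde S^{m-\frac12}}\frac{H^{m}+H^{m-1}}{2},\nabla_{\widetilde S^{m-\frac12}}\varphi^h\right)_{\widetilde S^{m-\frac12}}\right]\\ &+\frac{7}{90}\left[\left(\frac{-\mathbf X^{m+1}+4\mathbf X^m-3\mathbf X^{m-1}}{2\tau},\varphi^h\mathbf n^{m-1}\right)^h_{S^{m-1}}+\left(\nabla_{S^{m-1}}H^{m-1},\nabla_{S^{m-1}}\varphi^h\right)_{S^{m-1}}\right]=0, \end{aligned} $$ $$ \left(H^{m+1},\widetilde{\mathbf n}^{m+1}\cdot\boldsymbol\omega^h\right)^h_{\widetilde S^{m+1}}-\left(\nabla_{\widetilde S^{m+1}}\mathbf X^{m+1},\nabla_{\widetilde S^{m+1}}\boldsymbol\omega^h\right)_{\widetilde S^{m+1}}=0. $$ Then $V^{m+1}=V^{m-1}$. Moreover, let $(\mathbf X^m,H^m)_{m\ge0}$ be a sequence in $[\mathcal V^h]^3\times\mathcal V^h$ such that, for every $m\ge1$, $(\mathbf X^{m+1},H^{m+1})$ solves the BGN/VC scheme (the two variational equations displayed in this claim, with data $(\mathbf X^{m-1},H^{m-1})$, $(\mathbf X^m,H^m)$ and with $\widetilde{\mathbf X}^{m+1},\widetilde{\mathbf X}^{m+\frac12},\widetilde{\mathbf X}^{m-\frac12}$ the corresponding BGN1-predicted nodal maps).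 If the first step $(\mathbf X^1,H^1)$ is computed from $\mathbf X^0$ by the first-order structure-preserving PFEM (parametric finite element method) of Bao and Zhao (see context), so that $V^1=V^0$, then $V^m=V^0$ for all $m\ge0$.
   Context: Let $\widehat S_h=\bigcup_{j=1}^J\widehat\sigma_j$ be a fixed closed triangulated surface in $\mathbb R^3$ with no hanging vertices and nondegenerate triangles $\widehat\sigma_j$ with vertices $\widehat{\mathbf q}_{j1},\widehat{\mathbf q}_{j2},\widehat{\mathbf q}_{j3}$, ordered consistently so that the induced normal is outward. Let $\mathcal V^h=\{u\in C(\widehat S_h): u|_{\widehat\sigma_j}\in\mathbb P_1,\ j=1,\dots,J\}$ (continuous, affine on each triangle), and let $\tau>0$ be the time step. A nodal map $\mathbf Z\in[\mathcal V^h]^3$ represents the discrete surface $S_{\mathbf Z}=\mathbf Z(\widehat S_h)$, with triangles $\sigma_j(\mathbf Z)$ having vertices $\mathbf z_{jk}=\mathbf Z(\widehat{\mathbf q}_{jk})$; functions on $\widehat S_h$ are identified with functions on $S_{\mathbf Z}$ through $\mathbf Z$. Write $S^m=S_{\mathbf X^m}$. Oriented area vector: $\mathcal J_j(\mathbf Z)=(\mathbf z_{j2}-\mathbf z_{j1})\times(\mathbf z_{j3}-\mathbf z_{j1})$, and $\mathcal J(\mathbf Z)$ is the piecewise constant field equal to $\mathcal J_j(\mathbf Z)$ on the $j$-th triangle; $|\sigma_j(\mathbf Z)|=\frac12|\mathcal J_j(\mathbf Z)|$, and $\mathbf n_j(\mathbf Z)=\mathcal J_j(\mathbf Z)/|\mathcal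 J_j(\mathbf Z)|$. All discrete and predicted surfaces used in the scheme are assumed nondegenerate: $\min_j|\mathcal J_j(\mathbf Z)|>0$. The enclosed volume is $V(\mathbf Z)=\frac1{18}\sum_{j=1}^J\sum_{k=1}^3\mathbf z_{jk}\cdot\mathcal J_j(\mathbf Z)$, and $V^m=V(\mathbf X^m)$. Inner products: $(u,v)_{S_{\mathbf Z}}=\int_{S_{\mathbf Z}}u\cdot v\,dA$, and the mass-lumped product $(u,v)^h_{S_{\mathbf Z}}=\frac13\sum_{j=1}^J|\sigma_j(\mathbf Z)|\sum_{k=1}^3(u\cdot v)(\mathbf z_{jk})$, where piecewise continuous functions are evaluated at $\mathbf z_{jk}$ as limits from inside $\sigma_j(\mathbf Z)$. For $f\in\mathcal V^h$ with $f_{jk}=f(\widehat{\mathbf q}_{jk})$, the surface gradient is constant on each triangle: $$(\nabla_{S_{\mathbf Z}}f)|_{\sigma_j(\mathbf Z)}=\frac{\left[f_{j1}(\mathbf z_{j3}-\mathbf z_{j2})+f_{j2}(\mathbf z_{j1}-\mathbf z_{j3})+f_{j3}(\mathbf z_{j2}-\mathbf z_{j1})\right]\times\mathbf n_j(\mathbf Z)}{|\mathcal J_j(\mathbf Z)|}.$$ For vector-valued functions, $(\nabla_S\mathbf X,\nabla_S\boldsymbol\omega)_S=\sum_{\ell=1}^3(\nabla_SX_\ell,\nabla_S\omega_\ell)_S$. Predictors (BGN1 steps, the classical first-order Barrett–Garcke–Nürnberg scheme): for $k\ge0$ and a step $\theta>0$, a BGN1 step from $S^k$ with time step $\theta$ yields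 $\mathbf Y\in[\mathcal V^h]^3$, together with some $G\in\mathcal V^h$, satisfying for all $\varphi^h\in\mathcal V^h$, $\boldsymbol\omega^h\in[\mathcal V^h]^3$, with $\widehat{\mathbf n}=\mathcal J(\mathbf X^k)/|\mathcal J(\mathbf X^k)|$: $$\left(\frac{\mathbf Y-\mathbf X^k}{\theta},\varphi^h\widehat{\mathbf n}\right)^h_{S^k}+\left(\nabla_{S^k}G,\nabla_{S^k}\varphi^h\right)_{S^k}=0,\qquad\left(G,\widehat{\mathbf n}\cdot\boldsymbol\omega^h\right)^h_{S^k}-\left(\nabla_{S^k}\mathbf Y,\nabla_{S^k}\boldsymbol\omega^h\right)_{S^k}=0.$$ $\widetilde{\mathbf X}^{m+1}$ is obtained by a BGN1 step from $S^m$ with time step $\tau$; $\widetilde{\mathbf X}^{m+\frac12}$ by a BGN1 step from $S^m$ with time step $\tau/2$; $\widetilde{\mathbf X}^{m-\frac12}$ by a BGN1 step from $S^{m-1}$ with time step $\tau/2$ (i.e. it is the half-time predictor of the previous step; for $m=1$ it is generated from $S^0$ during the initialization). The corresponding surfaces are $\widetilde S^{m+1},\widetilde S^{m+\frac12},\widetilde S^{m-\frac12}$. Normals used in the step $m\to m+1$: the structure-preserving normals $$\mathbf n^{m+1}=\frac{\mathcal J(\mathbf X^{m+1})}{|\mathcal J(\widetilde{\mathbf X}^{m+1})|},\quad \mathbf n^{m+\frac12}=\frac{\mathcal J\left(-\frac18\mathbf X^{m-1}+\frac34\mathbf X^m+\frac38\mathbf X^{m+1}\right)}{|\mathcal J(\widetilde{\mathbf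 X}^{m+\frac12})|},\quad \mathbf n^{m-\frac12}=\frac{\mathcal J\left(\frac38\mathbf X^{m-1}+\frac34\mathbf X^m-\frac18\mathbf X^{m+1}\right)}{|\mathcal J(\widetilde{\mathbf X}^{m-\frac12})|},$$ the usual normals $\mathbf n^{m}=\mathcal J(\mathbf X^m)/|\mathcal J(\mathbf X^m)|$ and $\mathbf n^{m-1}=\mathcal J(\mathbf X^{m-1})/|\mathcal J(\mathbf X^{m-1})|$ at the known levels, and $\widetilde{\mathbf n}^{m+1}=\mathcal J(\widetilde{\mathbf X}^{m+1})/|\mathcal J(\widetilde{\mathbf X}^{m+1})|$. Starting step (first-order structure-preserving PFEM of Bao and Zhao, based on linear interpolation between two consecutive time levels): given $\mathbf X^0\in[\mathcal V^h]^3$, $(\mathbf X^1,H^1)\in[\mathcal V^h]^3\times\mathcal V^h$ satisfies for all $\varphi^h\in\mathcal V^h$, $\boldsymbol\omega^h\in[\mathcal V^h]^3$: $$\left(\frac{\mathbf X^1-\mathbf X^0}{\tau},\varphi^h\mathbf N\right)^h_{S^0}+\left(\nabla_{S^0}H^1,\nabla_{S^0}\varphi^h\right)_{S^0}=0,\qquad\left(H^1,\mathbf N\cdot\boldsymbol\omega^h\right)^h_{S^0}-\left(\nabla_{S^0}\mathbf X^1,\nabla_{S^0}\boldsymbol\omega^h\right)_{S^0}=0,$$ where $\mathbf N=\dfrac{\mathcal J(\mathbf X^0)+4\mathcal J\left(\frac12(\mathbf X^0+\mathbf X^1)\right)+\mathcal J(\mathbf X^1)}{6|\mathcal J(\mathbf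 X^0)|}$. This step gives $V^1=V^0$. *)

theory Defs
  imports "HOL-Analysis.Analysis"
begin

text \<open>
  A triangulation is given by the number \<open>J\<close> of triangles and the vertices \<open>q j k\<close> of the
  \<open>j\<close>-th triangle, \<open>1 \<le> j \<le> J\<close>. The vertex index \<open>k\<close> ranges over the type \<open>3\<close> of integers
  modulo 3, so \<open>k + 1\<close> is the cyclic successor of \<open>k\<close>.
  Functions on the triangulated surface are functions on the whole space of which only the
  values on the surface are ever used.
\<close>

definition tri :: "(nat \<Rightarrow> 3 \<Rightarrow> real^3) \<Rightarrow> nat \<Rightarrow> (real^3) set" where
  "tri q j = convex hull (range (q j))"

definition surf :: "nat \<Rightarrow> (nat \<Rightarrow> 3 \<Rightarrow> real^3) \<Rightarrow> (real^3) set" where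
  "surf J q = (\<Union>j\<in>{1..J}. tri q j)"

definition area_vec ::
  "(nat \<Rightarrow> 3 \<Rightarrow> real^3) \<Rightarrow> (real^3 \<Rightarrow> real^3) \<Rightarrow> nat \<Rightarrow> real^3" where
  "area_vec q Z j = cross3 (Z (q j 2) - Z (q j 1)) (Z (q j 3) - Z (q j 1))"

definition unit_normal ::
  "(nat \<Rightarrow> 3 \<Rightarrow> real^3) \<Rightarrow> (real^3 \<Rightarrow> real^3) \<Rightarrow> nat \<Rightarrow> real^3" where
  "unit_normal q Z j = area_vec q Z j /\<^sub>R norm (area_vec q Z j)"

definition tri_area ::
  "(nat \<Rightarrow> 3 \<Rightarrow> real^3) \<Rightarrow> (real^3 \<Rightarrow> real^3) \<Rightarrow> nat \<Rightarrow> real" where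
  "tri_area q Z j = norm (area_vec q Z j) / 2"

definition nondegenerate ::
  "nat \<Rightarrow> (nat \<Rightarrow> 3 \<Rightarrow> real^3) \<Rightarrow> (real^3 \<Rightarrow> real^3) \<Rightarrow> bool" where
  "nondegenerate J q Z \<longleftrightarrow> (\<forall>j\<in>{1..J}. norm (area_vec q Z j) > 0)"

definition vertex_star :: "nat \<Rightarrow> (nat \<Rightarrow> 3 \<Rightarrow> real^3) \<Rightarrow> real^3 \<Rightarrow> nat set" where
  "vertex_star J q p = {j\<in>{1..J}. p \<in> range (q j)}"

text \<open>
  Closed triangulated surface, in the usual sense for simplicial surfaces: distinct triangles
  meet exactly in the convex hull of their common vertices (no hanging vertices), every edge
  lies in exactly two triangles (no boundary), and the triangles at a vertex form a single fan,
  i.e. any two of them are joined by a chain of edge-adjacent triangles at that vertex.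
  Connectedness is not required.
\<close>

definition closed_triangulated_surface :: "nat \<Rightarrow> (nat \<Rightarrow> 3 \<Rightarrow> real^3) \<Rightarrow> bool" where
  "closed_triangulated_surface J q \<longleftrightarrow>
     J \<ge> 1 \<and>
     nondegenerate J q (\<lambda>x. x) \<and>
     (\<forall>i\<in>{1..J}. \<forall>j\<in>{1..J}. i \<noteq> j \<longrightarrow>
        range (q i) \<noteq> range (q j) \<and>
        tri q i \<inter> tri q j = convex hull (range (q i) \<inter> range (q j))) \<and>
     (\<forall>j\<in>{1..J}. \<forall>k l. k \<noteq> l \<longrightarrow>
        card {i\<in>{1..J}. q j k \<in> range (q i) \<and> q j l \<in> range (q i)} = 2) \<and>
     (\<forall>p. \<forall>i\<in>vertex_star J q p. \<forall>j\<in>vertex_star J q p.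
        (i, j) \<in> {(a, b). a \<in> vertex_star J q p \<and> b \<in> vertex_star J q p \<and>
                          card (range (q a) \<inter> range (q b)) \<ge> 2}\<^sup>*)"

text \<open>
  Consistent ordering: two distinct triangles never traverse a common edge in the same direction.
\<close>

definition consistently_ordered :: "nat \<Rightarrow> (nat \<Rightarrow> 3 \<Rightarrow> real^3) \<Rightarrow> bool" where
  "consistently_ordered J q \<longleftrightarrow>
     (\<forall>i\<in>{1..J}. \<forall>j\<in>{1..J}. i \<noteq> j \<longrightarrow>
        (\<forall>k l. \<not> (q i k = q j l \<and> q i (k + 1) = q j (l + 1))))"

text \<open>
  Outward normal: the surface is the boundary of a bounded open set, and the induced normal
  points out of that set at every relative interior point of every triangle.
\<close>

definition outward_ordered :: "nat \<Rightarrow> (nat \<Rightarrow> 3 \<Rightarrow> real^3) \<Rightarrow> bool" where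
  "outward_ordered J q \<longleftrightarrow>
     (\<exists>D. open D \<and> bounded D \<and> frontier D = surf J q \<and>
        (\<forall>j\<in>{1..J}. \<forall>x\<in>rel_interior (tri q j).
           \<forall>\<^sub>F t in at_right 0.
             x - t *\<^sub>R unit_normal q (\<lambda>y. y) j \<in> D \<and>
             x + t *\<^sub>R unit_normal q (\<lambda>y. y) j \<notin> closure D))"

definition fe_space :: "nat \<Rightarrow> (nat \<Rightarrow> 3 \<Rightarrow> real^3) \<Rightarrow> (real^3 \<Rightarrow> real) set" where
  "fe_space J q = {u. continuous_on (surf J q) u \<and>
     (\<forall>j\<in>{1..J}. \<exists>a b. \<forall>x\<in>tri q j. u x = a \<bullet> x + b)}"

definition fe_space3 :: "nat \<Rightarrow> (nat \<Rightarrow> 3 \<Rightarrow> real^3) \<Rightarrow> (real^3 \<Rightarrow> real^3) set" where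
  "fe_space3 J q = {Z. \<forall>l. (\<lambda>x. Z x $ l) \<in> fe_space J q}"

definition enclosed_volume :: "nat \<Rightarrow> (nat \<Rightarrow> 3 \<Rightarrow> real^3) \<Rightarrow> (real^3 \<Rightarrow> real^3) \<Rightarrow> real" where
  "enclosed_volume J q Z = 1/18 * (\<Sum>j=1..J. \<Sum>k\<in>UNIV. Z (q j k) \<bullet> area_vec q Z j)"

text \<open>
  A field that is continuous on each closed triangle but may jump across edges is a function
  \<open>u\<close> of the triangle index \<open>j\<close> and of a point of the reference triangle \<open>tri q j\<close>; the limit at
  a vertex from inside the \<open>j\<close>-th triangle is then \<open>u j (q j k)\<close>.
\<close>

definition lumped ::
  "nat \<Rightarrow> (nat \<Rightarrow> 3 \<Rightarrow> real^3) \<Rightarrow> (real^3 \<Rightarrow> real^3) \<Rightarrow>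
   (nat \<Rightarrow> real^3 \<Rightarrow> 'a::real_inner) \<Rightarrow> (nat \<Rightarrow> real^3 \<Rightarrow> 'a) \<Rightarrow> real" where
  "lumped J q Z u v =
     1/3 * (\<Sum>j=1..J. tri_area q Z j * (\<Sum>k\<in>UNIV. u j (q j k) \<bullet> v j (q j k)))"

text \<open>
  The surface integral over the image of the surface under \<open>Z\<close>, computed triangle by triangle
  in the affine parametrization by the unit triangle, whose area element on the \<open>j\<close>-th image
  triangle is \<open>norm (area_vec q Z j)\<close>.
\<close>

definition inner_surf ::
  "nat \<Rightarrow> (nat \<Rightarrow> 3 \<Rightarrow> real^3) \<Rightarrow> (real^3 \<Rightarrow> real^3) \<Rightarrow>
   (nat \<Rightarrow> real^3 \<Rightarrow> 'a::real_inner) \<Rightarrow> (nat \<Rightarrow> real^3 \<Rightarrow> 'a) \<Rightarrow> real" where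
  "inner_surf J q Z u v =
     (\<Sum>j=1..J. norm (area_vec q Z j) *
        set_lebesgue_integral lborel {(s::real, t::real). 0 \<le> s \<and> 0 \<le> t \<and> s + t \<le> 1}
          (\<lambda>(s, t). let x = q j 1 + s *\<^sub>R (q j 2 - q j 1) + t *\<^sub>R (q j 3 - q j 1)
                    in u j x \<bullet> v j x))"

text \<open>
  The discrete gradient uses the orientation \<open>edge \<times> normal\<close>; the overall sign relative to
  \<open>normal \<times> edge\<close> cancels in every bilinear form below.
\<close>

definition surf_grad ::
  "(nat \<Rightarrow> 3 \<Rightarrow> real^3) \<Rightarrow> (real^3 \<Rightarrow> real^3) \<Rightarrow> (real^3 \<Rightarrow> real) \<Rightarrow> nat \<Rightarrow> real^3" where
  "surf_grad q Z f j =
     cross3 (f (q j 1) *\<^sub>R (Z (q j 3) - Z (q j 2)) +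
             f (q j 2) *\<^sub>R (Z (q j 1) - Z (q j 3)) +
             f (q j 3) *\<^sub>R (Z (q j 2) - Z (q j 1))) (unit_normal q Z j)
       /\<^sub>R norm (area_vec q Z j)"

definition grad_inner ::
  "nat \<Rightarrow> (nat \<Rightarrow> 3 \<Rightarrow> real^3) \<Rightarrow> (real^3 \<Rightarrow> real^3) \<Rightarrow>
   (real^3 \<Rightarrow> real) \<Rightarrow> (real^3 \<Rightarrow> real) \<Rightarrow> real" where
  "grad_inner J q Z f g =
     inner_surf J q Z (\<lambda>j x. surf_grad q Z f j) (\<lambda>j x. surf_grad q Z g j)"

definition grad_inner3 ::
  "nat \<Rightarrow> (nat \<Rightarrow> 3 \<Rightarrow> real^3) \<Rightarrow> (real^3 \<Rightarrow> real^3) \<Rightarrow>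
   (real^3 \<Rightarrow> real^3) \<Rightarrow> (real^3 \<Rightarrow> real^3) \<Rightarrow> real" where
  "grad_inner3 J q Z Y W =
     (\<Sum>l\<in>UNIV. grad_inner J q Z (\<lambda>x. Y x $ l) (\<lambda>x. W x $ l))"

text \<open>
  The two residuals common to all schemes, on the surface with nodal map \<open>Z\<close>: the weak form of
  the velocity law (velocity \<open>U\<close>, normal \<open>N\<close>, potential \<open>K\<close>) and of the curvature relation.
\<close>

definition velocity_form ::
  "nat \<Rightarrow> (nat \<Rightarrow> 3 \<Rightarrow> real^3) \<Rightarrow> (real^3 \<Rightarrow> real^3) \<Rightarrow> (real^3 \<Rightarrow> real^3) \<Rightarrow>
   (nat \<Rightarrow> real^3) \<Rightarrow> (real^3 \<Rightarrow> real) \<Rightarrow> (real^3 \<Rightarrow> real) \<Rightarrow> real" where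
  "velocity_form J q Z U N K \<phi> =
     lumped J q Z (\<lambda>j. U) (\<lambda>j x. \<phi> x *\<^sub>R N j) + grad_inner J q Z K \<phi>"

definition curvature_form ::
  "nat \<Rightarrow> (nat \<Rightarrow> 3 \<Rightarrow> real^3) \<Rightarrow> (real^3 \<Rightarrow> real^3) \<Rightarrow> (real^3 \<Rightarrow> real) \<Rightarrow>
   (nat \<Rightarrow> real^3) \<Rightarrow> (real^3 \<Rightarrow> real^3) \<Rightarrow> (real^3 \<Rightarrow> real^3) \<Rightarrow> real" where
  "curvature_form J q Z K N Y \<omega> =
     lumped J q Z (\<lambda>j. K) (\<lambda>j x. N j \<bullet> \<omega> x) - grad_inner3 J q Z Y \<omega>"

definition bgn1_step ::
  "nat \<Rightarrow> (nat \<Rightarrow> 3 \<Rightarrow> real^3) \<Rightarrow> real \<Rightarrow> (real^3 \<Rightarrow> real^3) \<Rightarrow> (real^3 \<Rightarrow> real^3) \<Rightarrow> bool" where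
  "bgn1_step J q \<theta> X Y \<longleftrightarrow>
     Y \<in> fe_space3 J q \<and>
     (\<exists>G\<in>fe_space J q. \<forall>\<phi>\<in>fe_space J q. \<forall>\<omega>\<in>fe_space3 J q.
        velocity_form J q X (\<lambda>x. (Y x - X x) /\<^sub>R \<theta>) (unit_normal q X) G \<phi> = 0 \<and>
        curvature_form J q X G (unit_normal q X) Y \<omega> = 0)"

definition bao_zhao_normal ::
  "(nat \<Rightarrow> 3 \<Rightarrow> real^3) \<Rightarrow> (real^3 \<Rightarrow> real^3) \<Rightarrow> (real^3 \<Rightarrow> real^3) \<Rightarrow> nat \<Rightarrow> real^3" where
  "bao_zhao_normal q X Y j =
     (area_vec q X j + 4 *\<^sub>R area_vec q (\<lambda>x. (1/2) *\<^sub>R (X x + Y x)) j + area_vec q Y j)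
       /\<^sub>R (6 * norm (area_vec q X j))"

definition bao_zhao_step ::
  "nat \<Rightarrow> (nat \<Rightarrow> 3 \<Rightarrow> real^3) \<Rightarrow> real \<Rightarrow> (real^3 \<Rightarrow> real^3) \<Rightarrow>
   (real^3 \<Rightarrow> real^3) \<Rightarrow> (real^3 \<Rightarrow> real) \<Rightarrow> bool" where
  "bao_zhao_step J q \<tau> X Y K \<longleftrightarrow>
     Y \<in> fe_space3 J q \<and> K \<in> fe_space J q \<and>
     (\<forall>\<phi>\<in>fe_space J q. \<forall>\<omega>\<in>fe_space3 J q.
        velocity_form J q X (\<lambda>x. (Y x - X x) /\<^sub>R \<tau>) (bao_zhao_normal q X Y) K \<phi> = 0 \<and>
        curvature_form J q X K (bao_zhao_normal q X Y) Y \<omega> = 0)"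

definition sp_normal ::
  "(nat \<Rightarrow> 3 \<Rightarrow> real^3) \<Rightarrow> (real^3 \<Rightarrow> real^3) \<Rightarrow> (real^3 \<Rightarrow> real^3) \<Rightarrow> nat \<Rightarrow> real^3" where
  "sp_normal q Z P j = area_vec q Z j /\<^sub>R norm (area_vec q P j)"

text \<open>
  \<open>(X0, H0)\<close>, \<open>(X1, H1)\<close>, \<open>(X2, H2)\<close> are the time levels \<open>m - 1\<close>, \<open>m\<close>, \<open>m + 1\<close>, and
  \<open>Pm\<close>, \<open>Pp\<close>, \<open>P2\<close> the predictors at \<open>m - 1/2\<close>, \<open>m + 1/2\<close>, \<open>m + 1\<close>.
\<close>

definition bgn_vc_step ::
  "nat \<Rightarrow> (nat \<Rightarrow> 3 \<Rightarrow> real^3) \<Rightarrow> real \<Rightarrow>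
   (real^3 \<Rightarrow> real^3) \<Rightarrow> (real^3 \<Rightarrow> real) \<Rightarrow> (real^3 \<Rightarrow> real^3) \<Rightarrow> (real^3 \<Rightarrow> real) \<Rightarrow>
   (real^3 \<Rightarrow> real^3) \<Rightarrow> (real^3 \<Rightarrow> real^3) \<Rightarrow> (real^3 \<Rightarrow> real^3) \<Rightarrow>
   (real^3 \<Rightarrow> real^3) \<Rightarrow> (real^3 \<Rightarrow> real) \<Rightarrow> bool" where
  "bgn_vc_step J q \<tau> X0 H0 X1 H1 Pm Pp P2 X2 H2 \<longleftrightarrow>
     X2 \<in> fe_space3 J q \<and> H2 \<in> fe_space J q \<and>
     (\<forall>\<phi>\<in>fe_space J q. \<forall>\<omega>\<in>fe_space3 J q.
        7/90 * velocity_form J q P2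
                 (\<lambda>x. (3 *\<^sub>R X2 x - 4 *\<^sub>R X1 x + X0 x) /\<^sub>R (2 * \<tau>))
                 (sp_normal q X2 P2) H2 \<phi> +
        32/90 * velocity_form J q Pp
                 (\<lambda>x. (X2 x - X1 x) /\<^sub>R \<tau>)
                 (sp_normal q (\<lambda>x. (-1/8) *\<^sub>R X0 x + (3/4) *\<^sub>R X1 x + (3/8) *\<^sub>R X2 x) Pp)
                 (\<lambda>x. (H2 x + H1 x) / 2) \<phi> +
        12/90 * velocity_form J q X1
                 (\<lambda>x. (X2 x - X0 x) /\<^sub>R (2 * \<tau>))
                 (unit_normal q X1) H1 \<phi> +
        32/90 * velocity_form J q Pm
                 (\<lambda>x. (X1 x - X0 x) /\<^sub>R \<tau>)
                 (sp_normal q (\<lambda>x. (3/8) *\<^sub>R X0 x + (3/4) *\<^sub>R X1 x - (1/8) *\<^sub>R X2 x) Pm)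
                 (\<lambda>x. (H1 x + H0 x) / 2) \<phi> +
        7/90 * velocity_form J q X0
                 (\<lambda>x. (- X2 x + 4 *\<^sub>R X1 x - 3 *\<^sub>R X0 x) /\<^sub>R (2 * \<tau>))
                 (unit_normal q X0) H0 \<phi> = 0 \<and>
        curvature_form J q P2 H2 (unit_normal q P2) X2 \<omega> = 0)"

end

theory Submission
  imports Defs
begin

text \<open>
  Testing the velocity law with the constant function \<open>1\<close> kills every gradient term. Since the
  denominator of each structure-preserving normal is the area weight of the lumped product on
  the predicted surface, the two cancel, and what remains is a weighted sum of fluxes
  \<open>\<Sum>\<^sub>j \<Sum>\<^sub>k U(q\<^sub>j\<^sub>k) \<bullet> \<J>\<^sub>j(Z)\<close> (\<open>velocity_form_constant\<close>); the predictors have disappeared.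

  On a closed, consistently ordered surface this flux is the derivative of six times the enclosed
  volume at \<open>Z\<close> in the direction \<open>U\<close> (\<open>flux_area_vec\<close>). On a single triangle the two quantities
  differ by terms attached to the edges, which are antisymmetric in the endpoints and cancel
  because each edge is traversed once in either direction (\<open>sum_antisymmetric_over_edges\<close>).

  Now let \<open>Z(t)\<close> be the quadratic interpolant with \<open>Z(0) = X\<^sup>m\<^sup>-\<^sup>1\<close>, \<open>Z(1) = X\<^sup>m\<close>, \<open>Z(2) = X\<^sup>m\<^sup>+\<^sup>1\<close>.
  The volume is cubic in the nodal map, so \<open>d/dt V(Z(t))\<close> has degree five in \<open>t\<close>, and Boole's rule
  at \<open>t = 0, 1/2, 1, 3/2, 2\<close> integrates it exactly. The five terms of the scheme are the terms of
  this rule: the arguments of the normals are the values \<open>Z(t)\<close>, and the difference quotients are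
  the values \<open>Z'(t) / \<tau>\<close>. Hence \<open>V\<^sup>m\<^sup>+\<^sup>1 - V\<^sup>m\<^sup>-\<^sup>1\<close> is a multiple of the tested equation and vanishes. For
  the starting step, \<open>Z(t)\<close> is linear, the derivative is quadratic, and Simpson's rule plays the
  same part. Steps of length two and the starting step together reach every level from \<open>V\<^sup>0\<close>.
\<close>

section \<open>Testing the velocity law with a constant\<close>

lemma constant_one_in_fe_space: "(\<lambda>_. 1) \<in> fe_space J q"
proof -
  have "\<exists>a b. \<forall>x\<in>tri q j. (1::real) = a \<bullet> x + b" for j
    by (rule exI[of _ 0], rule exI[of _ 1]) simp
  then show ?thesis
    unfolding fe_space_def by auto
qed

lemma zero_in_fe_space3: "(\<lambda>_. 0) \<in> fe_space3 J q"
proof -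
  have "\<exists>a b. \<forall>x\<in>tri q j. (0::real) = a \<bullet> x + b" for j
    by (rule exI[of _ 0], rule exI[of _ 0]) simp
  then show ?thesis
    unfolding fe_space3_def fe_space_def by auto
qed

text \<open>The three edge vectors weighted by the nodal values in the discrete gradient sum to zero.\<close>

lemma grad_inner_constant: "grad_inner J q Z f (\<lambda>_. 1) = 0"
proof -
  have "surf_grad q Z (\<lambda>_. 1) j = 0" for j
  proof -
    have "(Z (q j 3) - Z (q j 2)) + (Z (q j 1) - Z (q j 3)) + (Z (q j 2) - Z (q j 1)) = 0"
      by simp
    then show ?thesis
      by (simp add: surf_grad_def)
  qed
  then show ?thesis
    by (simp add: grad_inner_def inner_surf_def Let_def set_lebesgue_integral_def case_prod_beta)
qed

text \<open>Six times the lumped integral of the normal velocity, with the area weights absorbed in \<open>A\<close>.\<close>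

definition flux ::
  "nat \<Rightarrow> (nat \<Rightarrow> 3 \<Rightarrow> real^3) \<Rightarrow> (real^3 \<Rightarrow> real^3) \<Rightarrow> (nat \<Rightarrow> real^3) \<Rightarrow> real" where
  "flux J q U A = (\<Sum>j=1..J. \<Sum>k\<in>UNIV. U (q j k) \<bullet> A j)"

lemma flux_divide: "flux J q (\<lambda>x. U x /\<^sub>R c) A = flux J q U A / c"
  by (simp add: flux_def sum_divide_distrib divide_inverse mult.commute sum_distrib_left)

text \<open>
  The vector \<open>A\<close> is left arbitrary so that the result covers the ordinary normals, the
  structure-preserving normals and the averaged normal of the starting step alike.
\<close>

lemma velocity_form_constant:
  assumes "nondegenerate J q P" and "\<And>j. N j = A j /\<^sub>R norm (area_vec q P j)"
  shows "velocity_form J q P U N K (\<lambda>_. 1) = flux J q U A / 6"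
proof -
  have "tri_area q P j * (\<Sum>k\<in>UNIV. U (q j k) \<bullet> (1 *\<^sub>R N j)) = (\<Sum>k\<in>UNIV. U (q j k) \<bullet> A j) / 2"
    if "j \<in> {1..J}" for j
  proof -
    have "norm (area_vec q P j) \<noteq> 0"
      using assms(1) that by (auto simp: nondegenerate_def)
    then show ?thesis
      by (simp add: tri_area_def assms(2) sum_3 field_simps)
  qed
  then have "(\<Sum>j=1..J. tri_area q P j * (\<Sum>k\<in>UNIV. U (q j k) \<bullet> (1 *\<^sub>R N j))) =
      (\<Sum>j=1..J. (\<Sum>k\<in>UNIV. U (q j k) \<bullet> A j) / 2)"
    by (rule sum.cong[OF refl])
  then have "lumped J q P (\<lambda>j. U) (\<lambda>j x. 1 *\<^sub>R N j) = flux J q U A / 6"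
    unfolding lumped_def flux_def by (simp add: sum_divide_distrib[symmetric])
  then show ?thesis
    by (simp add: velocity_form_def grad_inner_constant)
qed

section \<open>Cancellation over the edges of a closed surface\<close>

lemma inj_vertices:
  assumes "closed_triangulated_surface J q" and "j \<in> {1..J}"
  shows "inj (q j)"
proof -
  have "area_vec q (\<lambda>x. x) j \<noteq> 0"
    using assms by (auto simp: closed_triangulated_surface_def nondegenerate_def)
  then have "q j 1 \<noteq> q j 2" "q j 2 \<noteq> q j 3" "q j 3 \<noteq> q j 1"
    by (auto simp: area_vec_def cross_refl)
  then show ?thesis
    by (auto simp: inj_def forall_3)
qed

text \<open>
  An edge of a closed surface belongs to exactly one further triangle, and consistent ordering
  leaves only the opposite direction there.
\<close>

lemma edge_reversed_in_neighbour:
  assumes surf: "closed_triangulated_surface J q" "consistently_ordered J q"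
    and j: "j \<in> {1..J}"
  obtains i l where "i \<in> {1..J}" "q i l = q j (k + 1)" "q i (l + 1) = q j k"
proof -
  let ?E = "{i\<in>{1..J}. q j k \<in> range (q i) \<and> q j (k + 1) \<in> range (q i)}"
  have "k \<noteq> k + 1"
    by simp
  then have "card ?E = 2"
    using surf(1) j unfolding closed_triangulated_surface_def by blast
  then have "card (?E - {j}) = 1"
    using j by (subst card_Diff_singleton) auto
  then obtain i where "?E - {j} = {i}"
    by (rule card_1_singletonE)
  then have i: "i \<in> ?E" "i \<noteq> j"
    by blast+
  then obtain a b where ab: "q i a = q j k" "q i b = q j (k + 1)"
    by (auto elim!: rangeE)
  have "a \<noteq> b"
    using ab inj_vertices[OF surf(1) j] by (metis \<open>k \<noteq> k + 1\<close> injD)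
  moreover have "b \<noteq> a + 1"
    using ab i j surf(2) unfolding consistently_ordered_def by blast
  \<comment> \<open>Indices are taken modulo 3: two distinct ones are cyclically adjacent in one of the two orders.\<close>
  ultimately have "a = b + 1"
    using exhaust_3[of a] exhaust_3[of b] by auto
  then show thesis
    using that i ab by blast
qed

text \<open>
  The map from (triangle, index) to the directed edge is injective, and its image is closed under
  reversal of edges. Reversing every edge thus permutes the summands while changing the sign of
  the sum.
\<close>

lemma sum_antisymmetric_over_edges:
  fixes g :: "real^3 \<Rightarrow> real^3 \<Rightarrow> real"
  assumes surf: "closed_triangulated_surface J q" "consistently_ordered J q"
    and anti: "\<And>x y. g y x = - g x y"
  shows "(\<Sum>j=1..J. \<Sum>k\<in>UNIV. g (q j k) (q j (k + 1))) = 0"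
proof -
  let ?e = "\<lambda>(j, k). (q j k, q j (k + 1))"
  let ?D = "?e ` ({1..J} \<times> UNIV)"
  have inj: "inj_on ?e ({1..J} \<times> UNIV)"
  proof (rule inj_onI, clarsimp)
    fix i k j l
    assume h: "Suc 0 \<le> i" "i \<le> J" "Suc 0 \<le> j" "j \<le> J" "q i k = q j l" "q i (k + 1) = q j (l + 1)"
    then have "i = j"
      using surf(2) unfolding consistently_ordered_def by (metis One_nat_def atLeastAtMost_iff)
    moreover have "inj (q j)"
      using inj_vertices[OF surf(1), of j] h by simp
    ultimately show "i = j \<and> k = l"
      using h by (auto dest: injD)
  qed
  have swap_mem: "prod.swap e \<in> ?D" if "e \<in> ?D" for e
  proof -
    from that obtain j k where jk: "j \<in> {1..J}" "e = (q j k, q j (k + 1))"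
      by auto
    from edge_reversed_in_neighbour[OF surf jk(1), of k]
    obtain i l where il: "i \<in> {1..J}" "q i l = q j (k + 1)" "q i (l + 1) = q j k" .
    then show ?thesis
      using jk(2) by (intro image_eqI[of _ _ "(i, l)"]) auto
  qed
  then have swap: "bij_betw prod.swap ?D ?D"
    by (intro bij_betw_byWitness[where f' = prod.swap] image_subsetI swap_mem ballI swap_swap)
  have "(\<Sum>j=1..J. \<Sum>k\<in>UNIV. g (q j k) (q j (k + 1))) = (\<Sum>e\<in>?D. case_prod g e)"
    unfolding sum.reindex[OF inj] sum.cartesian_product by (simp add: case_prod_beta)
  moreover have "(\<Sum>e\<in>?D. case_prod g e) = - (\<Sum>e\<in>?D. case_prod g e)"
  proof -
    have "(\<Sum>e\<in>?D. case_prod g e) = (\<Sum>e\<in>?D. case_prod g (prod.swap e))"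
      by (rule sum.reindex_bij_betw[OF swap, symmetric])
    also have "\<dots> = (\<Sum>e\<in>?D. - case_prod g e)"
    proof (intro sum.cong refl)
      show "case_prod g (prod.swap e) = - case_prod g e" for e
        by (cases e) (simp, rule anti)
    qed
    finally show ?thesis
      by (simp only: sum_negf)
  qed
  ultimately show ?thesis
    by simp
qed

section \<open>The flux as the derivative of the volume\<close>

abbreviation triple :: "real^3 \<Rightarrow> real^3 \<Rightarrow> real^3 \<Rightarrow> real" where
  "triple a b c \<equiv> a \<bullet> cross3 b c"

text \<open>
  The derivative of the triple product at \<open>(a, b, c)\<close> in the direction \<open>(u, v, w)\<close>.
\<close>

definition triple_rate ::
  "real^3 \<Rightarrow> real^3 \<Rightarrow> real^3 \<Rightarrow> real^3 \<Rightarrow> real^3 \<Rightarrow> real^3 \<Rightarrow> real" where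
  "triple_rate u v w a b c = triple u b c + triple a v c + triple a b w"

text \<open>
  All three vertices of a triangle have the same inner product with its area vector.
\<close>

lemma enclosed_volume_triple:
  "6 * enclosed_volume J q Z = (\<Sum>j=1..J. triple (Z (q j 1)) (Z (q j 2)) (Z (q j 3)))"
proof -
  have "(\<Sum>k\<in>UNIV. Z (q j k) \<bullet> area_vec q Z j) = 3 * triple (Z (q j 1)) (Z (q j 2)) (Z (q j 3))" for j
    by (simp add: sum_3 area_vec_def cross3_def inner_vec_def algebra_simps)
  then show ?thesis
    by (simp add: enclosed_volume_def sum_distrib_left[symmetric])
qed

lemma four_eq_one: "(4::3) = 1"
  by simp

text \<open>
  The area vector is \<open>z\<^sub>1 \<times> z\<^sub>2 + z\<^sub>2 \<times> z\<^sub>3 + z\<^sub>3 \<times> z\<^sub>1\<close>. Each \<open>u\<^sub>k\<close> paired with the product of the two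
  other vertices gives a term of the derivative of the triple product; the remaining terms
  \<open>(u\<^sub>k + u\<^sub>l) \<bullet> (z\<^sub>k \<times> z\<^sub>l)\<close> belong to the edges and cancel globally.
\<close>

lemma flux_area_vec:
  assumes "closed_triangulated_surface J q" "consistently_ordered J q"
  shows "flux J q U (area_vec q Z) = 
    (\<Sum>j=1..J. triple_rate (U (q j 1)) (U (q j 2)) (U (q j 3)) (Z (q j 1)) (Z (q j 2)) (Z (q j 3)))"
proof -
  let ?g = "\<lambda>x y. triple (U x + U y) (Z x) (Z y)"
  have "(\<Sum>k\<in>UNIV. U (q j k) \<bullet> area_vec q Z j) =
          triple_rate (U (q j 1)) (U (q j 2)) (U (q j 3)) (Z (q j 1)) (Z (q j 2)) (Z (q j 3)) +
          (\<Sum>k\<in>UNIV. ?g (q j k) (q j (k + 1)))" for j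
    by (simp add: sum_3 four_eq_one area_vec_def triple_rate_def cross3_def inner_vec_def algebra_simps)
  moreover have "(\<Sum>j=1..J. \<Sum>k\<in>UNIV. ?g (q j k) (q j (k + 1))) = 0"
  proof (rule sum_antisymmetric_over_edges[OF assms])
    show "?g y x = - ?g x y" for x y
      by (simp add: cross_skew[of "Z y"] add.commute)
  qed
  ultimately show ?thesis
    by (simp add: flux_def sum.distrib)
qed

section \<open>Exact quadrature for the volume difference\<close>

lemmas triple_multilinear =
  inner_add_left inner_add_right inner_diff_left inner_diff_right
  inner_minus_left inner_minus_right inner_scaleR_left inner_scaleR_right
  cross_add_left cross_add_right cross_minus_left cross_minus_right
  Cross3.left_diff_distrib Cross3.right_diff_distrib cross_mult_left cross_mult_right

text \<open>
  Boole's rule on \<open>[0, 2]\<close> for the triple product along the quadratic curves through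
  \<open>a0, a1, a2\<close> and so on. It is exact because the derivative has degree five; after multilinear
  expansion it is a linear identity between the 27 products of the given vectors. The derivatives
  of the curves at the end points and at the midpoint are half of the differences used here; this
  factor is absorbed in the weights.
\<close>

lemma triple_boole:
  "triple a2 b2 c2 - triple a0 b0 c0 =
     7/90 * triple_rate (3 *\<^sub>R a2 - 4 *\<^sub>R a1 + a0) (3 *\<^sub>R b2 - 4 *\<^sub>R b1 + b0)
       (3 *\<^sub>R c2 - 4 *\<^sub>R c1 + c0) a2 b2 c2
   + 64/90 * triple_rate (a2 - a1) (b2 - b1) (c2 - c1)
       ((-1/8) *\<^sub>R a0 + (3/4) *\<^sub>R a1 + (3/8) *\<^sub>R a2)
       ((-1/8) *\<^sub>R b0 + (3/4) *\<^sub>R b1 + (3/8) *\<^sub>R b2)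
       ((-1/8) *\<^sub>R c0 + (3/4) *\<^sub>R c1 + (3/8) *\<^sub>R c2)
   + 12/90 * triple_rate (a2 - a0) (b2 - b0) (c2 - c0) a1 b1 c1
   + 64/90 * triple_rate (a1 - a0) (b1 - b0) (c1 - c0)
       ((3/8) *\<^sub>R a0 + (3/4) *\<^sub>R a1 - (1/8) *\<^sub>R a2)
       ((3/8) *\<^sub>R b0 + (3/4) *\<^sub>R b1 - (1/8) *\<^sub>R b2)
       ((3/8) *\<^sub>R c0 + (3/4) *\<^sub>R c1 - (1/8) *\<^sub>R c2)
   + 7/90 * triple_rate (- a2 + 4 *\<^sub>R a1 - 3 *\<^sub>R a0) (- b2 + 4 *\<^sub>R b1 - 3 *\<^sub>R b0)
       (- c2 + 4 *\<^sub>R c1 - 3 *\<^sub>R c0) a0 b0 c0"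
  unfolding triple_rate_def triple_multilinear by argo

text \<open>
  Simpson's rule along straight lines, where the derivative of the triple product is quadratic.
\<close>

lemma triple_simpson:
  "triple a1 b1 c1 - triple a0 b0 c0 =
     1/6 * triple_rate (a1 - a0) (b1 - b0) (c1 - c0) a0 b0 c0
   + 4/6 * triple_rate (a1 - a0) (b1 - b0) (c1 - c0)
       ((1/2) *\<^sub>R (a0 + a1)) ((1/2) *\<^sub>R (b0 + b1)) ((1/2) *\<^sub>R (c0 + c1))
   + 1/6 * triple_rate (a1 - a0) (b1 - b0) (c1 - c0) a1 b1 c1"
  unfolding triple_rate_def triple_multilinear by argo

lemma volume_difference_boole:
  assumes "closed_triangulated_surface J q" "consistently_ordered J q"
  shows "6 * enclosed_volume J q X2 - 6 * enclosed_volume J q X0 =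
      7/90 * flux J q (\<lambda>x. 3 *\<^sub>R X2 x - 4 *\<^sub>R X1 x + X0 x) (area_vec q X2)
    + 64/90 * flux J q (\<lambda>x. X2 x - X1 x)
        (area_vec q (\<lambda>x. (-1/8) *\<^sub>R X0 x + (3/4) *\<^sub>R X1 x + (3/8) *\<^sub>R X2 x))
    + 12/90 * flux J q (\<lambda>x. X2 x - X0 x) (area_vec q X1)
    + 64/90 * flux J q (\<lambda>x. X1 x - X0 x)
        (area_vec q (\<lambda>x. (3/8) *\<^sub>R X0 x + (3/4) *\<^sub>R X1 x - (1/8) *\<^sub>R X2 x))
    + 7/90 * flux J q (\<lambda>x. - X2 x + 4 *\<^sub>R X1 x - 3 *\<^sub>R X0 x) (area_vec q X0)"
  unfolding flux_area_vec[OF assms] enclosed_volume_triple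
    sum_distrib_left sum.distrib[symmetric] sum_subtractf[symmetric]
  by (intro sum.cong refl triple_boole)

lemma volume_difference_simpson:
  assumes "closed_triangulated_surface J q" "consistently_ordered J q"
  shows "6 * enclosed_volume J q Y - 6 * enclosed_volume J q X =
      1/6 * flux J q (\<lambda>x. Y x - X x) (area_vec q X)
    + 4/6 * flux J q (\<lambda>x. Y x - X x) (area_vec q (\<lambda>x. (1/2) *\<^sub>R (X x + Y x)))
    + 1/6 * flux J q (\<lambda>x. Y x - X x) (area_vec q Y)"
  unfolding flux_area_vec[OF assms] enclosed_volume_triple
    sum_distrib_left sum.distrib[symmetric] sum_subtractf[symmetric]
  by (intro sum.cong refl triple_simpson)

section \<open>Volume conservation\<close>

lemma bgn_vc_step_volume:
  assumes surf: "closed_triangulated_surface J q" "consistently_ordered J q" and "\<tau> > 0"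
    and nondeg: "nondegenerate J q X0" "nondegenerate J q X1"
      "nondegenerate J q Pm" "nondegenerate J q Pp" "nondegenerate J q P2"
    and step: "bgn_vc_step J q \<tau> X0 H0 X1 H1 Pm Pp P2 X2 H2"
  shows "enclosed_volume J q X2 = enclosed_volume J q X0"
proof -
  \<comment> \<open>The ordinary normals at the two known levels are structure-preserving normals whose
    predictor is the surface itself.\<close>
  note vf = velocity_form_constant[OF nondeg(1) unit_normal_def]
    velocity_form_constant[OF nondeg(2) unit_normal_def]
    velocity_form_constant[OF nondeg(3) sp_normal_def]
    velocity_form_constant[OF nondeg(4) sp_normal_def]
    velocity_form_constant[OF nondeg(5) sp_normal_def]
  show ?thesis
    using step[unfolded bgn_vc_step_def, THEN conjunct2, THEN conjunct2, rule_format,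
        OF constant_one_in_fe_space zero_in_fe_space3, THEN conjunct1,
        unfolded vf flux_divide]
      volume_difference_boole[OF surf, of X2 X0 X1] \<open>\<tau> > 0\<close>
    by (simp add: field_simps)
qed

lemma bao_zhao_step_volume:
  assumes surf: "closed_triangulated_surface J q" "consistently_ordered J q" and "\<tau> > 0"
    and nondeg: "nondegenerate J q X"
    and step: "bao_zhao_step J q \<tau> X Y K"
  shows "enclosed_volume J q Y = enclosed_volume J q X"
proof -
  let ?M = "\<lambda>x. (1/2) *\<^sub>R (X x + Y x)"
  let ?U = "\<lambda>x. Y x - X x"
  let ?A = "\<lambda>j. (1/6) *\<^sub>R (area_vec q X j + 4 *\<^sub>R area_vec q ?M j + area_vec q Y j)"
  have N: "bao_zhao_normal q X Y j = ?A j /\<^sub>R norm (area_vec q X j)" for j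
    by (simp add: bao_zhao_normal_def)
  have "flux J q ?U ?A = 1/6 * flux J q ?U (area_vec q X)
      + 4/6 * flux J q ?U (area_vec q ?M) + 1/6 * flux J q ?U (area_vec q Y)"
    unfolding flux_def sum_distrib_left sum.distrib[symmetric]
    by (intro sum.cong refl) (simp add: inner_add_right algebra_simps)
  moreover have "flux J q ?U ?A / \<tau> / 6 = 0"
    using step[unfolded bao_zhao_step_def, THEN conjunct2, THEN conjunct2, rule_format,
        OF constant_one_in_fe_space zero_in_fe_space3, THEN conjunct1]
    by (simp only: velocity_form_constant[OF nondeg N] flux_divide)
  ultimately show ?thesis
    using volume_difference_simpson[OF surf, of Y X] \<open>\<tau> > 0\<close> by simp
qed

theorem theorem2:
  fixes J :: nat and q :: "nat \<Rightarrow> 3 \<Rightarrow> real^3" and \<tau> :: real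
  assumes "closed_triangulated_surface J q"
    and "consistently_ordered J q"
    and "outward_ordered J q"
    and "\<tau> > 0"
  shows "(\<forall>(m::nat) (X :: nat \<Rightarrow> real^3 \<Rightarrow> real^3) (H :: nat \<Rightarrow> real^3 \<Rightarrow> real)
            (Pm :: real^3 \<Rightarrow> real^3) (Pp :: real^3 \<Rightarrow> real^3) (P2 :: real^3 \<Rightarrow> real^3).
            m \<ge> 1 \<and>
            X (m - 1) \<in> fe_space3 J q \<and> X m \<in> fe_space3 J q \<and>
            H (m - 1) \<in> fe_space J q \<and> H m \<in> fe_space J q \<and>
            bgn1_step J q (\<tau> / 2) (X (m - 1)) Pm \<and>
            bgn1_step J q (\<tau> / 2) (X m) Pp \<and>
            bgn1_step J q \<tau> (X m) P2 \<and>
            nondegenerate J q (X (m - 1)) \<and> nondegenerate J q (X m) \<and>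
            nondegenerate J q Pm \<and> nondegenerate J q Pp \<and> nondegenerate J q P2 \<and>
            bgn_vc_step J q \<tau> (X (m - 1)) (H (m - 1)) (X m) (H m) Pm Pp P2
              (X (m + 1)) (H (m + 1)) \<longrightarrow>
            enclosed_volume J q (X (m + 1)) = enclosed_volume J q (X (m - 1)))
       \<and>
         (\<forall>(X :: nat \<Rightarrow> real^3 \<Rightarrow> real^3) (H :: nat \<Rightarrow> real^3 \<Rightarrow> real)
            (Phalf :: nat \<Rightarrow> real^3 \<Rightarrow> real^3) (Pfull :: nat \<Rightarrow> real^3 \<Rightarrow> real^3).
            (\<forall>m. X m \<in> fe_space3 J q \<and> H m \<in> fe_space J q \<and> nondegenerate J q (X m)) \<and>
            (\<forall>m. bgn1_step J q (\<tau> / 2) (X m) (Phalf m) \<and> nondegenerate J q (Phalf m)) \<and>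
            (\<forall>m\<ge>1. bgn1_step J q \<tau> (X m) (Pfull (m + 1)) \<and> nondegenerate J q (Pfull (m + 1))) \<and>
            (\<forall>m\<ge>1. bgn_vc_step J q \<tau> (X (m - 1)) (H (m - 1)) (X m) (H m)
                     (Phalf (m - 1)) (Phalf m) (Pfull (m + 1)) (X (m + 1)) (H (m + 1))) \<and>
            bao_zhao_step J q \<tau> (X 0) (X 1) (H 1) \<longrightarrow>
            (\<forall>m. enclosed_volume J q (X m) = enclosed_volume J q (X 0)))"
proof (intro conjI allI impI; elim conjE)
  fix m X H Pm Pp P2
  assume "nondegenerate J q (X (m - 1))" "nondegenerate J q (X m)"
    "nondegenerate J q Pm" "nondegenerate J q Pp" "nondegenerate J q P2"
    "bgn_vc_step J q \<tau> (X (m - 1)) (H (m - 1)) (X m) (H m) Pm Pp P2 (X (m + 1)) (H (m + 1))"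
  then show "enclosed_volume J q (X (m + 1)) = enclosed_volume J q (X (m - 1))"
    by (rule bgn_vc_step_volume[OF assms(1,2,4)])
next
  fix X :: "nat \<Rightarrow> real^3 \<Rightarrow> real^3" and H Phalf Pfull m
  assume X: "\<forall>m. X m \<in> fe_space3 J q \<and> H m \<in> fe_space J q \<and> nondegenerate J q (X m)"
    and Phalf: "\<forall>m. bgn1_step J q (\<tau> / 2) (X m) (Phalf m) \<and> nondegenerate J q (Phalf m)"
    and Pfull: "\<forall>m\<ge>1. bgn1_step J q \<tau> (X m) (Pfull (m + 1)) \<and> nondegenerate J q (Pfull (m + 1))"
    and step: "\<forall>m\<ge>1. bgn_vc_step J q \<tau> (X (m - 1)) (H (m - 1)) (X m) (H m)
      (Phalf (m - 1)) (Phalf m) (Pfull (m + 1)) (X (m + 1)) (H (m + 1))"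
    and start: "bao_zhao_step J q \<tau> (X 0) (X 1) (H 1)"
  have two_step: "enclosed_volume J q (X (m + 2)) = enclosed_volume J q (X m)" for m
  proof (rule bgn_vc_step_volume[OF assms(1,2,4)])
    show "bgn_vc_step J q \<tau> (X m) (H m) (X (m + 1)) (H (m + 1))
        (Phalf m) (Phalf (m + 1)) (Pfull (m + 2)) (X (m + 2)) (H (m + 2))"
      using step[rule_format, of "m + 1"] by simp
    show "nondegenerate J q (Pfull (m + 2))"
      using Pfull[rule_format, of "m + 1"] by simp
  qed (use X Phalf in blast)+
  have first: "enclosed_volume J q (X 1) = enclosed_volume J q (X 0)"
    using bao_zhao_step_volume[OF assms(1,2,4) _ start] X by blast
  show "enclosed_volume J q (X m) = enclosed_volume J q (X 0)"
  proof (induction m rule: induct_nat_012)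
    case (ge2 n)
    then show ?case
      using two_step[of n] by simp
  qed (use first in simp_all)
qed

end
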